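(* Let $\mathbb K$ be a commutative field, $\Gamma_0\ne\{I\}$ a subgroup of $GL(n,\mathbb K)$, $\delta:\Gamma_0\to\Gamma_0$ an endomorphism, and $A,B\in GL(n,\mathbb K)$ such that no matrix $M^{-1}B^{-1}M^{\delta}A$, $M\in\Gamma_0$, has eigenvalue $1$; let $L_\Xi$ be the loop determined by $A,B,\Gamma_0,\delta$ (see context). Let $H=\{g(u,Au,I);\ u\in\mathbb K^n\}$ be the stabilizer of $\mathcal Q_A$ in $\Gamma$. Then $L_\Xi$ is isomorphic to a loop $L_\Xi'$ whose elements are the elements of the orbit $$\widehat{\mathcal O}=\{\psi(\mathcal Q_A);\ \psi\in\Xi\}=\{\varphi(\mathcal Q_A);\ \varphi\in\Gamma\}.$$ The loop $L_\Xi'$ has $\mathcal Q_A$ as the identity, and its multiplication is defined by $$X\circ Y=\tau_{\mathcal Q_A,X}(Y)\quad\text{for all }X,Y\in\widehat{\mathcal O},$$ where $\tau_{\mathcal Q_A,X}$ is the unique element of $\Xi$ mapping $\mathcal Q_A$ onto $X$. Moreover, the group $\Gamma_0'$ acts sharply transitively on the traces of the elements of $\mathcal O=\{\varphi(\mathcal Q_A);\ \varphi\in\Gamma_0'\}$ in the hyperplane $E$ at infinity, and the subspace $\{(1,x,Bx);\ x\in\mathbb K^n\}$ intersects any subspace in $\mathcal O$ in precisely one point.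
   Context: $\Gamma$ is the group of matrices $g(u,v,M)=\begin{pmatrix} 1 & 0 & 0 \\ u & M & 0 \\ v & 0 & M^{\delta} \end{pmatrix}$ with $u,v\in\mathbb K^n$ (column vectors), $M\in\Gamma_0$. It acts on the $2n$-dimensional affine space $\mathcal A_{2n}=\{(1,x,y);\ x,y\in\mathbb K^n\}$ by $g(u,v,M)(1,x,y)=(1,u+Mx,v+M^{\delta}y)$. Put $\Gamma_0'=\{g(0,0,M);\ M\in\Gamma_0\}$, $T_B=\{g(u,Bu,I);\ u\in\mathbb K^n\}$, $\Xi=T_B\Gamma_0'$. Under the eigenvalue assumption, $\Xi$ acts sharply transitively on the left cosets $\Gamma/H$ (for all cosets $aH,bH$ there is exactly one $\xi\in\Xi$ with $\xi aH=bH$), and $\Xi$ is the image of a section $\sigma:\Gamma/H\to\Gamma$ with $\sigma(H)=1$, where $\sigma(xH)$ is the unique element of $\Xi\cap xH$. The loop $L_\Xi$ is $\Gamma/H$ with multiplication $xH\ast yH=\sigma(xH)\,yH$. (A loop is a set with a binary operation with two-sided identity in which $a\cdot y=b$ and $x\cdot a=b$ are uniquely solvable.) For $C\in GL(n,\mathbb K)$ let $\mathcal Q_C=\{(1,x,Cx);\ x\in\mathbb K^n\}$. The hyperplane at infinity of $\mathcal A_{2n}$ is the projective space $E=\{\mathbb K^*(0,x,y);\ x,y\in\mathbb K^n,(x,y)\ne(0,0)\}$, $\mathbb K^*=\mathbb K\setminus\{0\}$, on which $g(0,0,M)\in\Gamma_0'$ acts by $\mathbb K^*(0,x,y)\mapsto\mathbb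 K^*(0,Mx,M^{\delta}y)$. The trace of $\mathcal Q_C$ in $E$ is $\mathcal Q_C^*=\{\mathbb K^*(0,x,Cx);\ 0\neq x\in\mathbb K^n\}$. *)

theory Defs
  imports
    "HOL-Analysis.Determinants"
    "HOL-Algebra.Left_Coset"
    "HOL-Algebra.Group_Action"
begin

text \<open>Loops are presented as records of type \<open>monoid\<close>, so that \<open>iso\<close> and \<open>\<cong>\<close>, which do not
  presuppose associativity, can be used for them.\<close>

locale loop =
  fixes L (structure)
  assumes m_closed: "\<lbrakk>x \<in> carrier L; y \<in> carrier L\<rbrakk> \<Longrightarrow> x \<otimes> y \<in> carrier L"
    and one_closed: "\<one> \<in> carrier L"
    and l_one: "x \<in> carrier L \<Longrightarrow> \<one> \<otimes> x = x"
    and r_one: "x \<in> carrier L \<Longrightarrow> x \<otimes> \<one> = x"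
    and l_div: "\<lbrakk>a \<in> carrier L; b \<in> carrier L\<rbrakk> \<Longrightarrow> \<exists>!y. y \<in> carrier L \<and> a \<otimes> y = b"
    and r_div: "\<lbrakk>a \<in> carrier L; b \<in> carrier L\<rbrakk> \<Longrightarrow> \<exists>!x. x \<in> carrier L \<and> x \<otimes> a = b"

definition sharply_transitive :: "'s set \<Rightarrow> 'x set \<Rightarrow> ('s \<Rightarrow> 'x \<Rightarrow> 'x) \<Rightarrow> bool" where
  "sharply_transitive S X \<phi> \<longleftrightarrow>
     (\<forall>s\<in>S. \<forall>x\<in>X. \<phi> s x \<in> X) \<and>
     (\<forall>x\<in>X. \<forall>y\<in>X. \<exists>!s. s \<in> S \<and> \<phi> s x = y)"

definition GL :: "('k::field^'m^'m) monoid" where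
  "GL = \<lparr>carrier = {M. invertible M}, mult = (**), one = mat 1\<rparr>"

definition eigenvalue :: "'k::field^'n^'n \<Rightarrow> 'k \<Rightarrow> bool" where
  "eigenvalue M c \<longleftrightarrow> (\<exists>x. x \<noteq> 0 \<and> M *v x = c *s x)"

lemma group_GL: "group (GL :: ('k::field^'m^'m) monoid)"
proof (rule groupI)
  fix M :: "'k^'m^'m"
  assume "M \<in> carrier GL"
  then show "\<exists>N\<in>carrier GL. N \<otimes>\<^bsub>GL\<^esub> M = \<one>\<^bsub>GL\<^esub>"
    by (auto simp: GL_def invertible_def)
next
  show "\<one>\<^bsub>GL\<^esub> \<in> carrier (GL :: ('k^'m^'m) monoid)"
    by (auto simp: GL_def invertible_def intro!: exI[of _ "mat 1"])
qed (auto simp: GL_def invertible_mult matrix_mul_assoc)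

text \<open>Vectors $(a,x,y)$ with a scalar $a$ and $x,y\in K^n$ are indexed by the type
  \<open>unit + 'n + 'n\<close>; the matrices in $\Gamma$ are block matrices over the same index type.\<close>

definition vec3 :: "'k::field \<Rightarrow> 'k^'n \<Rightarrow> 'k^'n \<Rightarrow> 'k^(unit + 'n + 'n)" where
  "vec3 a x y = (\<chi> i. case i of Inl _ \<Rightarrow> a | Inr (Inl p) \<Rightarrow> x $ p | Inr (Inr p) \<Rightarrow> y $ p)"

definition gmat :: "('k::field^'n^'n \<Rightarrow> 'k^'n^'n) \<Rightarrow> 'k^'n \<Rightarrow> 'k^'n \<Rightarrow> 'k^'n^'n
    \<Rightarrow> 'k^(unit + 'n + 'n)^(unit + 'n + 'n)" where
  "gmat \<delta> u v M = (\<chi> i j. case i of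
      Inl _ \<Rightarrow> (case j of Inl _ \<Rightarrow> 1 | Inr (Inl q) \<Rightarrow> 0 | Inr (Inr q) \<Rightarrow> 0)
    | Inr (Inl p) \<Rightarrow> (case j of Inl _ \<Rightarrow> u $ p | Inr (Inl q) \<Rightarrow> M $ p $ q | Inr (Inr q) \<Rightarrow> 0)
    | Inr (Inr p) \<Rightarrow> (case j of Inl _ \<Rightarrow> v $ p | Inr (Inl q) \<Rightarrow> 0 | Inr (Inr q) \<Rightarrow> \<delta> M $ p $ q))"

definition Gam :: "('k::field^'n^'n) set \<Rightarrow> ('k^'n^'n \<Rightarrow> 'k^'n^'n)
    \<Rightarrow> ('k^(unit + 'n + 'n)^(unit + 'n + 'n)) set" where
  "Gam \<Gamma>0 \<delta> = {gmat \<delta> u v M |u v M. M \<in> \<Gamma>0}"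

abbreviation Gam_group :: "('k::field^'n^'n) set \<Rightarrow> ('k^'n^'n \<Rightarrow> 'k^'n^'n)
    \<Rightarrow> ('k^(unit + 'n + 'n)^(unit + 'n + 'n)) monoid" where
  "Gam_group \<Gamma>0 \<delta> \<equiv> GL\<lparr>carrier := Gam \<Gamma>0 \<delta>\<rparr>"

definition Gam0' :: "('k::field^'n^'n) set \<Rightarrow> ('k^'n^'n \<Rightarrow> 'k^'n^'n)
    \<Rightarrow> ('k^(unit + 'n + 'n)^(unit + 'n + 'n)) set" where
  "Gam0' \<Gamma>0 \<delta> = {gmat \<delta> 0 0 M |M. M \<in> \<Gamma>0}"

text \<open>For $C=B$ this is $T_B$; for $C=A$ it is the subgroup $H$.\<close>

definition transl :: "('k::field^'n^'n \<Rightarrow> 'k^'n^'n) \<Rightarrow> 'k^'n^'n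
    \<Rightarrow> ('k^(unit + 'n + 'n)^(unit + 'n + 'n)) set" where
  "transl \<delta> C = {gmat \<delta> u (C *v u) (mat 1) |u. True}"

definition Xi :: "('k::field^'n^'n) set \<Rightarrow> ('k^'n^'n \<Rightarrow> 'k^'n^'n) \<Rightarrow> 'k^'n^'n
    \<Rightarrow> ('k^(unit + 'n + 'n)^(unit + 'n + 'n)) set" where
  "Xi \<Gamma>0 \<delta> B = transl \<delta> B <#>\<^bsub>GL\<^esub> Gam0' \<Gamma>0 \<delta>"

definition act :: "'k::field^'m^'m \<Rightarrow> ('k^'m) set \<Rightarrow> ('k^'m) set" where
  "act g X = (\<lambda>p. g *v p) ` X"

definition Q :: "'k::field^'n^'n \<Rightarrow> ('k^(unit + 'n + 'n)) set" where
  "Q C = {vec3 1 x (C *v x) |x. True}"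

text \<open>If $\Xi$ meets every left coset in exactly one element, \<open>sigma\<close> is the section of
  $\Gamma/H$ with image $\Xi$.\<close>

definition sigma :: "('k::field^'n^'n) set \<Rightarrow> ('k^'n^'n \<Rightarrow> 'k^'n^'n) \<Rightarrow> 'k^'n^'n
    \<Rightarrow> ('k^(unit + 'n + 'n)^(unit + 'n + 'n)) set \<Rightarrow> 'k^(unit + 'n + 'n)^(unit + 'n + 'n)" where
  "sigma \<Gamma>0 \<delta> B X = (THE \<xi>. \<xi> \<in> Xi \<Gamma>0 \<delta> B \<inter> X)"

definition L_Xi :: "('k::field^'n^'n) set \<Rightarrow> ('k^'n^'n \<Rightarrow> 'k^'n^'n) \<Rightarrow> 'k^'n^'n \<Rightarrow> 'k^'n^'n
    \<Rightarrow> ('k^(unit + 'n + 'n)^(unit + 'n + 'n)) set monoid" where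
  "L_Xi \<Gamma>0 \<delta> A B =
     \<lparr>carrier = lcosets\<^bsub>Gam_group \<Gamma>0 \<delta>\<^esub> (transl \<delta> A),
      mult = (\<lambda>X Y. sigma \<Gamma>0 \<delta> B X <#\<^bsub>Gam_group \<Gamma>0 \<delta>\<^esub> Y),
      one = transl \<delta> A\<rparr>"

definition Ohat :: "('k::field^'n^'n) set \<Rightarrow> ('k^'n^'n \<Rightarrow> 'k^'n^'n) \<Rightarrow> 'k^'n^'n \<Rightarrow> 'k^'n^'n
    \<Rightarrow> ('k^(unit + 'n + 'n)) set set" where
  "Ohat \<Gamma>0 \<delta> A B = {act \<psi> (Q A) |\<psi>. \<psi> \<in> Xi \<Gamma>0 \<delta> B}"

definition tau :: "('k::field^'n^'n) set \<Rightarrow> ('k^'n^'n \<Rightarrow> 'k^'n^'n) \<Rightarrow> 'k^'n^'n \<Rightarrow> 'k^'n^'n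
    \<Rightarrow> ('k^(unit + 'n + 'n)) set \<Rightarrow> 'k^(unit + 'n + 'n)^(unit + 'n + 'n)" where
  "tau \<Gamma>0 \<delta> A B X = (THE \<psi>. \<psi> \<in> Xi \<Gamma>0 \<delta> B \<and> act \<psi> (Q A) = X)"

definition L_Xi' :: "('k::field^'n^'n) set \<Rightarrow> ('k^'n^'n \<Rightarrow> 'k^'n^'n) \<Rightarrow> 'k^'n^'n \<Rightarrow> 'k^'n^'n
    \<Rightarrow> ('k^(unit + 'n + 'n)) set monoid" where
  "L_Xi' \<Gamma>0 \<delta> A B =
     \<lparr>carrier = Ohat \<Gamma>0 \<delta> A B,
      mult = (\<lambda>X Y. act (tau \<Gamma>0 \<delta> A B X) Y),
      one = Q A\<rparr>"

definition proj :: "'k::field^'m \<Rightarrow> ('k^'m) set" where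
  "proj p = {c *s p |c. c \<noteq> 0}"

definition E :: "('k::field^(unit + 'n::finite + 'n)) set set" where
  "E = {proj (vec3 0 x y) |x y. (x, y) \<noteq> (0, 0)}"

definition trace_Q :: "'k::field^'n^'n \<Rightarrow> ('k^(unit + 'n + 'n)) set set" where
  "trace_Q C = {proj (vec3 0 x (C *v x)) |x. x \<noteq> 0}"

definition act_trace :: "'k::field^'m^'m \<Rightarrow> ('k^'m) set set \<Rightarrow> ('k^'m) set set" where
  "act_trace g T = act g ` T"

definition Orb0 :: "('k::field^'n^'n) set \<Rightarrow> ('k^'n^'n \<Rightarrow> 'k^'n^'n) \<Rightarrow> 'k^'n^'n
    \<Rightarrow> ('k^(unit + 'n + 'n)) set set" where
  "Orb0 \<Gamma>0 \<delta> A = {act \<phi> (Q A) |\<phi>. \<phi> \<in> Gam0' \<Gamma>0 \<delta>}"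

text \<open>Every element of \<open>Orb0 \<Gamma>0 \<delta> A\<close> is of the form \<open>Q C\<close> (see \<open>act_Q\<close> below), so all of them
  have a trace here.\<close>

definition traces :: "('k::field^(unit + 'n::finite + 'n)) set set \<Rightarrow> ('k^(unit + 'n + 'n)) set set set" where
  "traces \<O> = {trace_Q C |C. invertible C \<and> Q C \<in> \<O>}"

lemma sum_blocks:
  fixes f :: "unit + 'n::finite + 'n \<Rightarrow> 'a::comm_monoid_add"
  shows "(\<Sum>i\<in>UNIV. f i) = f (Inl ()) + ((\<Sum>p\<in>UNIV. f (Inr (Inl p))) + (\<Sum>p\<in>UNIV. f (Inr (Inr p))))"
  by (simp only: UNIV_Plus_UNIV[symmetric] sum.Plus finite) (simp add: UNIV_unit)

lemma gmat_vec3: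
  "gmat \<delta> u v M *v vec3 a x y = vec3 a (a *s u + M *v x) (a *s v + \<delta> M *v y)"
proof -
  have "(gmat \<delta> u v M *v vec3 a x y) $ i = vec3 a (a *s u + M *v x) (a *s v + \<delta> M *v y) $ i" for i
  proof (cases i)
    case (Inl t)
    then show ?thesis
      by (simp add: matrix_vector_mult_def sum_blocks gmat_def vec3_def)
  next
    case (Inr j)
    then show ?thesis
      by (cases j) (simp_all add: matrix_vector_mult_def sum_blocks gmat_def vec3_def mult.commute)
  qed
  then show ?thesis
    by (simp add: vec_eq_iff)
qed

lemma trace_Q_subset_E: "trace_Q C \<subseteq> E"
  by (auto simp: trace_Q_def E_def)

lemma act_proj: "act g (proj p) = proj (g *v p)"
proof -
  have "g *v (c *s p) = c *s (g *v p)" for c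
    by (rule vector_scalar_commute)
  then show ?thesis
    unfolding act_def proj_def by (simp add: setcompr_eq_image image_image)
qed

lemma act_Q:
  assumes "M ** N = mat 1" "N ** M = mat 1"
  shows "act (gmat \<delta> 0 0 M) (Q C) = Q (\<delta> M ** C ** N)"
proof -
  have 1: "gmat \<delta> 0 0 M *v vec3 1 x (C *v x) =
      vec3 1 (M *v x) ((\<delta> M ** C ** N) *v (M *v x))" for x
    using assms by (simp add: gmat_vec3 matrix_vector_mul_assoc flip: matrix_mul_assoc)
  have 2: "vec3 1 x ((\<delta> M ** C ** N) *v x) = gmat \<delta> 0 0 M *v vec3 1 (N *v x) (C *v (N *v x))" for x
    using assms by (simp add: gmat_vec3 matrix_vector_mul_assoc matrix_mul_assoc)
  show ?thesis
    unfolding act_def Q_def using 1 2 by blast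
qed

end

theory Submission
  imports Defs
begin

text \<open>Every image of \<open>Q A\<close> under \<open>\<Gamma>\<close> is the graph of an affine map \<open>x \<mapsto> C x + w\<close> with slope
  \<open>C = M\<^sup>\<delta> A M\<^sup>-\<^sup>1\<close>. That \<open>H\<close> is the whole stabilizer of \<open>Q A\<close> makes \<open>M\<close> recoverable from \<open>C\<close>, and the
  eigenvalue condition says that every \<open>B - C\<close> is invertible. An element \<open>g(u, Bu, M)\<close> of \<open>\<Xi>\<close>
  multiplies the parameter of the slope by \<open>M\<close> on the left and changes the translation part \<open>w\<close> into
  \<open>M\<^sup>\<delta> w + (B - C') u\<close>, where \<open>C'\<close> is the new slope; hence \<open>\<Xi>\<close> is sharply transitive on the
  orbit. For any group action, a subset of the group that contains \<open>1\<close> and is sharply transitive on an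
  orbit makes both the orbit and the cosets of a stabilizer into loops, isomorphic under the
  orbit-stabilizer correspondence.\<close>

section \<open>Loops from sharply transitive sections\<close>

text \<open>\<open>S\<close> need not be a subgroup, so the loops below need not be associative.
  Sharpness is required on the orbit, where it can be computed; the orbit-stabilizer correspondence
  carries it over to cosets.\<close>

locale sharp_transversal = group_action G Z \<phi> for G (structure) and Z and \<phi> +
  fixes p and S
  assumes point: "p \<in> Z"
    and S_subset: "S \<subseteq> carrier G"
    and one_S: "\<one> \<in> S"
    and sharp: "sharply_transitive S (orbit G \<phi> p) \<phi>"
begin

sublocale group G
  using group_hom group_hom.axioms(1) by blast

text \<open>This and \<open>representative\<close> are definite descriptions of the same shape as
  \<open>tau\<close> and \<open>sigma\<close>, so that \<open>L_Xi'\<close> and \<open>L_Xi\<close>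
  become instances of the loops below by unfolding.\<close>

definition transporter :: "'c \<Rightarrow> 'a" where
  "transporter X = (THE s. s \<in> S \<and> \<phi> s p = X)"

definition representative :: "'a set \<Rightarrow> 'a" where
  "representative X = (THE s. s \<in> S \<inter> X)"

definition orbit_loop :: "'c monoid" where
  "orbit_loop = \<lparr>carrier = orbit G \<phi> p, mult = (\<lambda>X Y. \<phi> (transporter X) Y), one = p\<rparr>"

definition coset_loop :: "'a set monoid" where
  "coset_loop = \<lparr>carrier = lcosets (stabilizer G \<phi> p),
     mult = (\<lambda>X Y. representative X <# Y), one = stabilizer G \<phi> p\<rparr>"

section \<open>Elementary facts on the orbit and its transporters\<close>

lemma S_carrier: "s \<in> S \<Longrightarrow> s \<in> carrier G"
  using S_subset by blast

lemma one_act: "x \<in> Z \<Longrightarrow> \<phi> \<one> x = x"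
  by (metis id_eq_one restrict_apply')

lemma orbit_subset: "orbit G \<phi> p \<subseteq> Z"
  using element_image point by (auto simp: orbit_def)

lemma point_orbit: "p \<in> orbit G \<phi> p"
  by (rule orbit_refl[OF point])

lemma orbitI: "g \<in> carrier G \<Longrightarrow> \<phi> g p \<in> orbit G \<phi> p"
  by (auto simp: orbit_def)

lemma S_orbit: "s \<in> S \<Longrightarrow> x \<in> orbit G \<phi> p \<Longrightarrow> \<phi> s x \<in> orbit G \<phi> p"
  using sharp by (auto simp: sharply_transitive_def)

lemma ex1_S: "x \<in> orbit G \<phi> p \<Longrightarrow> y \<in> orbit G \<phi> p \<Longrightarrow> \<exists>!s. s \<in> S \<and> \<phi> s x = y"
  using sharp by (auto simp: sharply_transitive_def)

lemma ex1_transporter: "X \<in> orbit G \<phi> p \<Longrightarrow> \<exists>!s. s \<in> S \<and> \<phi> s p = X"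
  by (rule ex1_S[OF point_orbit])

lemma transporter:
  assumes "X \<in> orbit G \<phi> p"
  shows "transporter X \<in> S" "\<phi> (transporter X) p = X"
  using theI'[OF ex1_transporter[OF assms]] by (auto simp: transporter_def)

lemma transporter_eq: "s \<in> S \<Longrightarrow> transporter (\<phi> s p) = s"
  using ex1_transporter[of "\<phi> s p"] transporter[of "\<phi> s p"] S_carrier orbitI by blast

lemma orbit_eq_S: "orbit G \<phi> p = {\<phi> s p |s. s \<in> S}"
proof
  show "orbit G \<phi> p \<subseteq> {\<phi> s p |s. s \<in> S}"
    using transporter by force
qed (auto intro: orbitI S_carrier)

text \<open>Left division works because each group element permutes the orbit; right division is the
  sharp transitivity of \<open>S\<close>. Since \<open>\<one> \<in> S\<close>, the transporter of
  \<open>p\<close> is \<open>\<one>\<close>, which makes \<open>p\<close> a left identity.\<close>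

theorem loop_orbit_loop: "loop orbit_loop"
proof
  fix x y
  assume x: "x \<in> carrier orbit_loop" and y: "y \<in> carrier orbit_loop"
  then show "x \<otimes>\<^bsub>orbit_loop\<^esub> y \<in> carrier orbit_loop"
    by (simp add: orbit_loop_def S_orbit transporter)
next
  show "\<one>\<^bsub>orbit_loop\<^esub> \<in> carrier orbit_loop"
    by (simp add: orbit_loop_def point_orbit)
next
  fix x assume x: "x \<in> carrier orbit_loop"
  have "transporter p = \<one>"
    using transporter_eq[OF one_S] one_act point by simp
  with x show "\<one>\<^bsub>orbit_loop\<^esub> \<otimes>\<^bsub>orbit_loop\<^esub> x = x"
    using orbit_subset by (auto simp: orbit_loop_def one_act)
  show "x \<otimes>\<^bsub>orbit_loop\<^esub> \<one>\<^bsub>orbit_loop\<^esub> = x"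
    using x by (simp add: orbit_loop_def transporter)
next
  fix a b
  assume ab: "a \<in> carrier orbit_loop" "b \<in> carrier orbit_loop"
  then have a: "a \<in> orbit G \<phi> p" and b: "b \<in> orbit G \<phi> p"
    by (auto simp: orbit_loop_def)
  let ?t = "transporter a"
  have t: "?t \<in> carrier G"
    using a transporter S_carrier by blast
  \<comment> \<open>\<open>inv ?t\<close> need not lie in \<open>S\<close>, so
    \<open>S_orbit\<close> does not apply; the orbit is closed under the whole group.\<close>
  have inv_t: "\<phi> (inv ?t) b \<in> orbit G \<phi> p"
  proof -
    obtain g where g: "g \<in> carrier G" "b = \<phi> g p"
      using b by (auto simp: orbit_def)
    then have "\<phi> (inv ?t) b = \<phi> (inv ?t \<otimes> g) p"
      using t point by (simp add: composition_rule)
    then show ?thesis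
      using g t by (simp add: orbitI)
  qed
  have "\<phi> ?t (\<phi> (inv ?t) b) = b"
    using b t orbit_subset by (metis composition_rule inv_closed one_act r_inv subsetD)
  moreover have "y = y'" if "y \<in> orbit G \<phi> p" "y' \<in> orbit G \<phi> p" "\<phi> ?t y = \<phi> ?t y'" for y y'
    using that inj_prop[OF t] orbit_subset by (meson inj_onD subsetD)
  ultimately show "\<exists>!y. y \<in> carrier orbit_loop \<and> a \<otimes>\<^bsub>orbit_loop\<^esub> y = b"
    using inv_t unfolding orbit_loop_def by (auto intro!: ex1I[of _ "\<phi> (inv ?t) b"])
  \<comment> \<open>Any right quotient \<open>x\<close> must have transporter \<open>s\<close>,
    hence equals \<open>\<phi> s p\<close>.\<close>
  obtain s where s: "s \<in> S" "\<phi> s a = b" and u: "\<And>s'. s' \<in> S \<Longrightarrow> \<phi> s' a = b \<Longrightarrow> s' = s"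
    using ex1_S[OF a b] by blast
  show "\<exists>!x. x \<in> carrier orbit_loop \<and> x \<otimes>\<^bsub>orbit_loop\<^esub> a = b"
  proof (rule ex1I[of _ "\<phi> s p"])
    show "\<phi> s p \<in> carrier orbit_loop \<and> \<phi> s p \<otimes>\<^bsub>orbit_loop\<^esub> a = b"
      using s by (simp add: orbit_loop_def orbitI S_carrier transporter_eq)
    fix x assume x: "x \<in> carrier orbit_loop \<and> x \<otimes>\<^bsub>orbit_loop\<^esub> a = b"
    then have "transporter x = s"
      by (auto simp: orbit_loop_def transporter intro: u)
    with x show "x = \<phi> s p"
      using transporter(2)[of x] by (auto simp: orbit_loop_def)
  qed
qed

text \<open>Left cosets of the stabilizer are the fibres of the map sending \<open>g\<close> to
  \<open>\<phi> g p\<close>: two elements agree at \<open>p\<close> iff their quotient fixes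
  \<open>p\<close>.\<close>

lemma mem_l_coset_stabilizer:
  assumes g: "g \<in> carrier G"
  shows "x \<in> g <# stabilizer G \<phi> p \<longleftrightarrow> x \<in> carrier G \<and> \<phi> x p = \<phi> g p"
proof
  assume "x \<in> g <# stabilizer G \<phi> p"
  then show "x \<in> carrier G \<and> \<phi> x p = \<phi> g p"
    using g point by (auto simp: l_coset_def stabilizer_def composition_rule)
next
  assume x: "x \<in> carrier G \<and> \<phi> x p = \<phi> g p"
  then have "\<phi> (inv g \<otimes> x) p = p"
    using g point by (metis composition_rule inv_closed one_act l_inv)
  then have "inv g \<otimes> x \<in> stabilizer G \<phi> p"
    using x g by (simp add: stabilizer_def)
  moreover have "x = g \<otimes> (inv g \<otimes> x)"
    using x g by (simp add: m_assoc[symmetric])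
  ultimately show "x \<in> g <# stabilizer G \<phi> p"
    unfolding l_coset_def by blast
qed

text \<open>By the fibre description, the elements of \<open>S\<close> in the coset are exactly
  those moving \<open>p\<close> to \<open>\<phi> g p\<close>, so both descriptions pick the same
  element.\<close>

lemma representative_l_coset:
  assumes "g \<in> carrier G"
  shows "representative (g <# stabilizer G \<phi> p) = transporter (\<phi> g p)"
proof -
  have "s \<in> S \<inter> (g <# stabilizer G \<phi> p) \<longleftrightarrow> s \<in> S \<and> \<phi> s p = \<phi> g p" for s
    using assms S_carrier by (auto simp: mem_l_coset_stabilizer)
  then show ?thesis
    by (simp add: representative_def transporter_def)
qed

lemma coset_mult:
  assumes "g \<in> carrier G" "h \<in> carrier G"
  shows "(g <# stabilizer G \<phi> p) \<otimes>\<^bsub>coset_loop\<^esub> (h <# stabilizer G \<phi> p)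
    = (transporter (\<phi> g p) \<otimes> h) <# stabilizer G \<phi> p"
  using assms transporter(1)[OF orbitI] S_carrier
  by (simp add: coset_loop_def representative_l_coset lcos_m_assoc stabilizer_subset)

lemma coset_cases:
  assumes "X \<in> carrier coset_loop"
  obtains g where "g \<in> carrier G" "X = g <# stabilizer G \<phi> p"
  using assms by (auto simp: coset_loop_def LCOSETS_def)

text \<open>The orbit-stabilizer bijection. The representative in \<open>S\<close> avoids a quotient
  construction; any other representative gives the same point.\<close>

definition coset_point :: "'a set \<Rightarrow> 'c" where
  "coset_point X = \<phi> (representative X) p"

lemma coset_point: "g \<in> carrier G \<Longrightarrow> coset_point (g <# stabilizer G \<phi> p) = \<phi> g p"
  by (simp add: coset_point_def representative_l_coset transporter orbitI)

text \<open>Multiplicativity is the composition rule of the action applied to a transporter and a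
  coset representative; injectivity holds because cosets are fibres.\<close>

theorem coset_point_iso: "coset_point \<in> iso coset_loop orbit_loop"
proof -
  have "coset_point \<in> hom coset_loop orbit_loop"
  proof (rule homI)
    fix X assume "X \<in> carrier coset_loop"
    then show "coset_point X \<in> carrier orbit_loop"
      by (elim coset_cases) (simp add: coset_point orbit_loop_def orbitI)
  next
    fix X Y assume "X \<in> carrier coset_loop" "Y \<in> carrier coset_loop"
    then obtain g h where "g \<in> carrier G" "X = g <# stabilizer G \<phi> p"
      and "h \<in> carrier G" "Y = h <# stabilizer G \<phi> p"
      by (elim coset_cases)
    then show "coset_point (X \<otimes>\<^bsub>coset_loop\<^esub> Y)
        = coset_point X \<otimes>\<^bsub>orbit_loop\<^esub> coset_point Y"
      using transporter(1)[OF orbitI, of g] S_carrier point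
      by (simp add: coset_mult coset_point orbit_loop_def composition_rule)
  qed
  moreover have "inj_on coset_point (carrier coset_loop)"
  proof (rule inj_onI, elim coset_cases)
    fix X Y g h
    assume "coset_point X = coset_point Y" "g \<in> carrier G" "X = g <# stabilizer G \<phi> p"
      "h \<in> carrier G" "Y = h <# stabilizer G \<phi> p"
    then show "X = Y"
      by (auto simp: coset_point mem_l_coset_stabilizer)
  qed
  moreover have "carrier orbit_loop \<subseteq> coset_point ` carrier coset_loop"
  proof
    fix x assume "x \<in> carrier orbit_loop"
    then obtain g where "g \<in> carrier G" "x = coset_point (g <# stabilizer G \<phi> p)"
      by (auto simp: orbit_loop_def orbit_def coset_point)
    then show "x \<in> coset_point ` carrier coset_loop"
      by (auto simp: coset_loop_def LCOSETS_def)
  qed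
  ultimately show ?thesis
    by (auto simp: iso_iff hom_def)
qed

end

text \<open>Bijectivity carries unique solvability back from \<open>K\<close>. Closure and the
  identity are separate hypotheses because \<open>iso\<close> does not make the carrier of
  \<open>L\<close> closed and does not speak of identities.\<close>

lemma loop_pullback:
  fixes L (structure) and K (structure)
  assumes K: "loop K" and f: "f \<in> iso L K"
    and closed: "\<And>x y. \<lbrakk>x \<in> carrier L; y \<in> carrier L\<rbrakk> \<Longrightarrow> x \<otimes>\<^bsub>L\<^esub> y \<in> carrier L"
    and one: "\<one>\<^bsub>L\<^esub> \<in> carrier L" "f \<one>\<^bsub>L\<^esub> = \<one>\<^bsub>K\<^esub>"
  shows "loop L"
proof -
  interpret K: loop K by (rule K)
  have mult: "f (x \<otimes>\<^bsub>L\<^esub> y) = f x \<otimes>\<^bsub>K\<^esub> f y" if "x \<in> carrier L" "y \<in> carrier L" for x y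
    using f that by (auto simp: iso_def hom_def)
  have img: "f x \<in> carrier K" if "x \<in> carrier L" for x
    using f that by (auto simp: iso_def hom_def)
  have inj: "x = y" if "f x = f y" "x \<in> carrier L" "y \<in> carrier L" for x y
    using f that by (auto simp: iso_iff dest: inj_onD)
  have surj: "\<exists>x\<in>carrier L. f x = z" if "z \<in> carrier K" for z
    using f that unfolding iso_iff by (metis imageE)
  show ?thesis
  proof
    fix x assume x: "x \<in> carrier L"
    show "\<one>\<^bsub>L\<^esub> \<otimes>\<^bsub>L\<^esub> x = x"
      by (rule inj) (use x one closed in \<open>auto simp: mult img K.l_one\<close>)
    show "x \<otimes>\<^bsub>L\<^esub> \<one>\<^bsub>L\<^esub> = x"
      by (rule inj) (use x one closed in \<open>auto simp: mult img K.r_one\<close>)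
  next
    fix a b assume a: "a \<in> carrier L" and b: "b \<in> carrier L"
    \<comment> \<open>By injectivity, an equation in \<open>L\<close> is equivalent to its image in
      \<open>K\<close>.\<close>
    have eq: "x \<otimes>\<^bsub>L\<^esub> y = b \<longleftrightarrow> f x \<otimes>\<^bsub>K\<^esub> f y = f b" if "x \<in> carrier L" "y \<in> carrier L" for x y
      using that b closed inj mult by metis
    show "\<exists>!y. y \<in> carrier L \<and> a \<otimes>\<^bsub>L\<^esub> y = b"
      using K.l_div[OF img[OF a] img[OF b]] eq[OF a] surj img inj by metis
    show "\<exists>!x. x \<in> carrier L \<and> x \<otimes>\<^bsub>L\<^esub> a = b"
      using K.r_div[OF img[OF a] img[OF b]] eq[OF _ a] surj img inj by metis
  qed (use closed one in auto)
qed

theorem (in sharp_transversal) loop_coset_loop: "loop coset_loop"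
proof (rule loop_pullback[OF loop_orbit_loop coset_point_iso])
  fix X Y assume "X \<in> carrier coset_loop" "Y \<in> carrier coset_loop"
  then obtain g h where "g \<in> carrier G" "X = g <# stabilizer G \<phi> p"
    and "h \<in> carrier G" "Y = h <# stabilizer G \<phi> p"
    by (elim coset_cases)
  then show "X \<otimes>\<^bsub>coset_loop\<^esub> Y \<in> carrier coset_loop"
    using transporter(1)[OF orbitI, of g] S_carrier
    by (auto simp: coset_mult) (auto simp: coset_loop_def LCOSETS_def)
next
  \<comment> \<open>Writing the identity as the coset of \<open>\<one>\<close> lets
    \<open>coset_point\<close> be evaluated on it.\<close>
  have *: "\<one> <# stabilizer G \<phi> p = stabilizer G \<phi> p"
    by (rule lcos_mult_one[OF stabilizer_subset])
  then show "\<one>\<^bsub>coset_loop\<^esub> \<in> carrier coset_loop"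
    by (auto simp: coset_loop_def LCOSETS_def)
  show "coset_point \<one>\<^bsub>coset_loop\<^esub> = \<one>\<^bsub>orbit_loop\<^esub>"
    using coset_point[OF one_closed] point by (simp add: * coset_loop_def orbit_loop_def one_act)
qed

section \<open>Block matrices acting on affine graphs\<close>

lemma vec3_inject [simp]: "vec3 a x y = vec3 b x' y' \<longleftrightarrow> a = b \<and> x = x' \<and> y = y'"
proof
  assume eq: "vec3 a x y = vec3 b x' y'"
  have "vec3 a x y $ i = vec3 b x' y' $ i" for i
    using eq by simp
  from this[of "Inl ()"] this[of "Inr (Inl _)"] this[of "Inr (Inr _)"]
  show "a = b \<and> x = x' \<and> y = y'"
    by (simp add: vec3_def vec_eq_iff)
qed simp

lemma scale_vec3: "c *s vec3 a x y = vec3 (c * a) (c *s x) (c *s y)"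
  by (auto simp: vec3_def vec_eq_iff split: sum.split)

lemma vec3_cases: obtains a x y where "z = vec3 a x y"
proof
  show "z = vec3 (z $ Inl ()) (\<chi> p. z $ Inr (Inl p)) (\<chi> p. z $ Inr (Inr p))"
    by (auto simp: vec3_def vec_eq_iff split: sum.split)
qed

lemma gmat_inject:
  assumes "gmat \<delta> u v M = gmat \<delta> u' v' M'"
  shows "u = u' \<and> v = v' \<and> M = M'"
proof -
  have eq: "gmat \<delta> u v M *v vec3 a x y = gmat \<delta> u' v' M' *v vec3 a x y" for a x y
    using assms by simp
  \<comment> \<open>The vector (1,0,0) reveals the translation parts \<open>u\<close> and
    \<open>v\<close>, the vectors (0,x,0) reveal \<open>M\<close>.\<close>
  from eq[of 1 0 0] eq[of 0 _ 0] show ?thesis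
    by (simp add: gmat_vec3 matrix_eq)
qed

text \<open>Matrices agreeing on all vectors are equal, so applying both sides to (a,x,y) replaces
  the sums over the block index. Multiplicativity of \<open>\<delta>\<close> enters only at the pair
  \<open>M\<close>, \<open>N\<close>.\<close>

lemma gmat_mult:
  assumes "\<delta> (M ** N) = \<delta> M ** \<delta> N"
  shows "gmat \<delta> u v M ** gmat \<delta> u' v' N = gmat \<delta> (u + M *v u') (v + \<delta> M *v v') (M ** N)"
proof -
  have "(gmat \<delta> u v M ** gmat \<delta> u' v' N) *v z
      = gmat \<delta> (u + M *v u') (v + \<delta> M *v v') (M ** N) *v z" for z
    by (cases z rule: vec3_cases)
       (simp add: gmat_vec3 assms matrix_vector_mul_assoc[symmetric] matrix_vector_right_distrib
         vector_scalar_commute vector_add_ldistrib add.assoc)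
  then show ?thesis
    by (simp add: matrix_eq)
qed

lemma gmat_one:
  assumes "\<delta> (mat 1) = mat 1"
  shows "gmat \<delta> 0 0 (mat 1) = mat 1"
proof -
  have "gmat \<delta> 0 0 (mat 1) *v z = mat 1 *v z" for z
    by (cases z rule: vec3_cases) (simp add: gmat_vec3 assms)
  then show ?thesis
    by (simp add: matrix_eq)
qed

lemma act_mult: "act (g ** h) X = act g (act h X)"
  by (simp add: act_def image_image matrix_vector_mul_assoc)

lemma act_one: "act (mat 1) X = X"
  by (simp add: act_def)

text \<open>Each matrix permutes the sets of vectors because its inverse in the group undoes
  it.\<close>

lemma group_action_act:
  assumes G: "group (GL\<lparr>carrier := C\<rparr>)"
  shows "group_action (GL\<lparr>carrier := C\<rparr>) UNIV act"
proof -
  interpret group "GL\<lparr>carrier := C\<rparr>" by (rule G)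
  have one: "act (mat 1) = (\<lambda>X. X)" and mult: "act (g ** h) = act g \<circ> act h" for g h
    by (auto simp: act_one act_mult)
  have bij: "act g \<in> Bij UNIV" if g: "g \<in> C" for g
  proof -
    obtain h where "h ** g = mat 1" "g ** h = mat 1"
      using l_inv[of g] r_inv[of g] g by (auto simp: GL_def)
    then have "act h (act g X) = X" "act g (act h X) = X" for X
      by (simp_all add: act_one flip: act_mult)
    then have "bij (act g)"
      by (intro bijI') metis+
    then show ?thesis
      by (simp add: Bij_def)
  qed
  have "act \<in> hom (GL\<lparr>carrier := C\<rparr>) (BijGroup UNIV)"
    by (rule homI) (auto simp: bij BijGroup_def GL_def mult compose_def)
  then show ?thesis
    unfolding group_action_def group_hom_def group_hom_axioms_def
    using G group_BijGroup by auto
qed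

lemma matrix_inv:
  assumes "invertible M"
  shows "M ** matrix_inv M = mat 1" "matrix_inv M ** M = mat 1"
  using someI_ex[OF assms[unfolded invertible_def]] by (auto simp: matrix_inv_def)

lemma matrix_inv_unique:
  assumes "M ** N = mat 1" "N ** M = mat 1"
  shows "matrix_inv M = N"
proof -
  have "invertible M"
    using assms by (auto simp: invertible_def)
  then show ?thesis
    using assms by (metis matrix_inv(2) matrix_mul_assoc matrix_mul_lid matrix_mul_rid)
qed

text \<open>Images of \<open>Q A\<close> need not pass through (1,0,0); the offset \<open>w\<close>
  records where they meet \<open>x = 0\<close>.\<close>

definition graph :: "'k::field^'n^'n \<Rightarrow> 'k^'n \<Rightarrow> ('k^(unit + 'n + 'n)) set" where
  "graph C w = {vec3 1 x (C *v x + w) |x. True}"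

lemma Q_eq_graph: "Q C = graph C 0"
  by (simp add: Q_def graph_def)

lemma mem_graph: "vec3 a x y \<in> graph C w \<longleftrightarrow> a = 1 \<and> y = C *v x + w"
  by (auto simp: graph_def)

lemma graph_inject [simp]: "graph C w = graph D z \<longleftrightarrow> C = D \<and> w = z"
proof
  assume "graph C w = graph D z"
  then have eq: "C *v x + w = D *v x + z" for x
    using mem_graph[of 1 x "C *v x + w" C w] by (simp add: mem_graph)
  from this[of 0] have "w = z" by simp
  with eq show "C = D \<and> w = z"
    by (simp add: matrix_eq)
qed simp

text \<open>Substitute \<open>u + M *v x\<close> for the first coordinate; conversely, the preimage
  of a point with first coordinate \<open>x\<close> has first coordinate
  \<open>N *v (x - u)\<close>.\<close>

lemma act_graph:
  assumes "M ** N = mat 1" "N ** M = mat 1"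
  shows "act (gmat \<delta> u v M) (graph C w)
    = graph (\<delta> M ** C ** N) (v + \<delta> M *v w - (\<delta> M ** C ** N) *v u)"
proof -
  let ?D = "\<delta> M ** C ** N"
  have M: "M *v (N *v x) = x" "N *v (M *v x) = x" for x
    using assms by (simp_all add: matrix_vector_mul_assoc)
  have D: "?D *v x = \<delta> M *v (C *v (N *v x))" for x
    by (simp add: matrix_vector_mul_assoc matrix_mul_assoc)
  have 1: "gmat \<delta> u v M *v vec3 1 x (C *v x + w)
      = vec3 1 (u + M *v x) (?D *v (u + M *v x) + (v + \<delta> M *v w - ?D *v u))" for x
    by (simp add: gmat_vec3 matrix_vector_right_distrib D M)
  have 2: "vec3 1 x (?D *v x + (v + \<delta> M *v w - ?D *v u))
      = gmat \<delta> u v M *v vec3 1 (N *v (x - u)) (C *v (N *v (x - u)) + w)" for x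
    unfolding 1 by (simp add: M)
  show ?thesis
    unfolding act_def graph_def using 1 2 by blast
qed

text \<open>A common point at infinity gives \<open>x = c *s y\<close> and
  \<open>C *v x = c *s (D *v y)\<close>, so by linearity \<open>C\<close> and \<open>D\<close> agree
  at \<open>x\<close>.\<close>

lemma trace_Q_inject:
  assumes "trace_Q C = trace_Q D"
  shows "C = D"
proof -
  have "C *v x = D *v x" for x
  proof (cases "x = 0")
    case False
    then have "proj (vec3 0 x (C *v x)) \<in> trace_Q D"
      unfolding assms[symmetric] by (auto simp: trace_Q_def)
    then obtain y where "proj (vec3 0 x (C *v x)) = proj (vec3 0 y (D *v y))"
      by (auto simp: trace_Q_def)
    moreover have "vec3 0 x (C *v x) \<in> proj (vec3 0 x (C *v x))"
      unfolding proj_def by (intro CollectI exI[of _ 1]) simp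
    ultimately have "vec3 0 x (C *v x) \<in> proj (vec3 0 y (D *v y))"
      by simp
    then obtain c where "vec3 0 x (C *v x) = c *s vec3 0 y (D *v y)"
      by (auto simp: proj_def)
    then have "x = c *s y" "C *v x = c *s (D *v y)"
      unfolding scale_vec3 vec3_inject by blast+
    then show ?thesis
      by (simp only: vector_scalar_commute)
  qed simp
  then show ?thesis
    by (simp add: matrix_eq)
qed

text \<open>The counterpart of \<open>act_graph\<close> at infinity; \<open>M\<close> and
  \<open>N\<close> are mutually inverse, so nonzero vectors correspond to nonzero vectors.\<close>

lemma act_trace_Q:
  assumes "M ** N = mat 1" "N ** M = mat 1"
  shows "act_trace (gmat \<delta> 0 0 M) (trace_Q C) = trace_Q (\<delta> M ** C ** N)"
proof -
  let ?D = "\<delta> M ** C ** N"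
  have M: "M *v (N *v x) = x" "N *v (M *v x) = x" for x
    using assms by (simp_all add: matrix_vector_mul_assoc)
  have nz: "M *v x = 0 \<longleftrightarrow> x = 0" "N *v x = 0 \<longleftrightarrow> x = 0" for x
    by (metis M matrix_vector_mult_0_right)+
  have D: "?D *v x = \<delta> M *v (C *v (N *v x))" for x
    by (simp add: matrix_vector_mul_assoc matrix_mul_assoc)
  have 1: "act (gmat \<delta> 0 0 M) (proj (vec3 0 x (C *v x))) = proj (vec3 0 (M *v x) (?D *v (M *v x)))" for x
    by (simp add: act_proj gmat_vec3 D M)
  have 2: "proj (vec3 0 x (?D *v x))
      = act (gmat \<delta> 0 0 M) (proj (vec3 0 (N *v x) (C *v (N *v x))))" for x
    unfolding 1 by (simp add: M)
  show ?thesis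
    unfolding act_trace_def trace_Q_def 
  proof (intro equalityI subsetI)
    fix q assume "q \<in> {proj (vec3 0 x (?D *v x)) |x. x \<noteq> 0}"
    then obtain x where "q = proj (vec3 0 x (?D *v x))" "x \<noteq> 0"
      by blast
    then show "q \<in> act (gmat \<delta> 0 0 M) ` {proj (vec3 0 x (C *v x)) |x. x \<noteq> 0}"
      using 2[of x] nz(2)[of x] by blast
  next
    fix q assume "q \<in> act (gmat \<delta> 0 0 M) ` {proj (vec3 0 x (C *v x)) |x. x \<noteq> 0}"
    then obtain x where "q = act (gmat \<delta> 0 0 M) (proj (vec3 0 x (C *v x)))" "x \<noteq> 0"
      by blast
    then show "q \<in> {proj (vec3 0 x (?D *v x)) |x. x \<noteq> 0}"
      using 1[of x] nz(1)[of x] by blast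
  qed
qed

section \<open>The group \<open>\<Gamma>\<close> and the transversal \<open>\<Xi>\<close>\<close>

locale twisted_action =
  fixes \<Gamma>0 :: "('k::field^'n^'n) set"
    and \<delta> :: "'k^'n^'n \<Rightarrow> 'k^'n^'n"
    and A B :: "'k^'n^'n"
  assumes subgroup: "subgroup \<Gamma>0 GL"
    and hom: "\<delta> \<in> hom (GL\<lparr>carrier := \<Gamma>0\<rparr>) (GL\<lparr>carrier := \<Gamma>0\<rparr>)"
    and A: "A \<in> carrier GL"
    and B: "B \<in> carrier GL"
    and no_eigenvalue: "\<forall>M\<in>\<Gamma>0. \<not> eigenvalue (matrix_inv M ** matrix_inv B ** \<delta> M ** A) 1"
    and stabilizer: "transl \<delta> A = stabilizer (Gam_group \<Gamma>0 \<delta>) act (Q A)"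
begin

section \<open>Closure properties and the group structure\<close>

lemma Gam0_mult: "M \<in> \<Gamma>0 \<Longrightarrow> N \<in> \<Gamma>0 \<Longrightarrow> M ** N \<in> \<Gamma>0"
  using subgroup.m_closed[OF subgroup] by (simp add: GL_def)

lemma Gam0_one: "mat 1 \<in> \<Gamma>0"
  using subgroup.one_closed[OF subgroup] by (simp add: GL_def)

lemma invertible: "M \<in> \<Gamma>0 \<Longrightarrow> invertible M"
  using subgroup.subset[OF subgroup] by (auto simp: GL_def)

lemma Gam0_inv: "M \<in> \<Gamma>0 \<Longrightarrow> matrix_inv M \<in> \<Gamma>0"
proof -
  assume M: "M \<in> \<Gamma>0"
  interpret GL: group "GL :: ('k^'n^'n) monoid" by (rule group_GL)
  have c: "M \<in> carrier GL" using M invertible by (simp add: GL_def)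
  have "matrix_inv M = inv\<^bsub>GL\<^esub> M"
    using GL.l_inv[OF c] GL.r_inv[OF c] by (intro matrix_inv_unique) (simp_all add: GL_def)
  then show ?thesis
    using subgroup.m_inv_closed[OF subgroup M] by simp
qed

lemma delta_mult: "M \<in> \<Gamma>0 \<Longrightarrow> N \<in> \<Gamma>0 \<Longrightarrow> \<delta> (M ** N) = \<delta> M ** \<delta> N"
  using hom by (auto simp: hom_def GL_def)

lemma delta_closed: "M \<in> \<Gamma>0 \<Longrightarrow> \<delta> M \<in> \<Gamma>0"
  using hom by (auto simp: hom_def)

text \<open>The image of the identity is idempotent and invertible, hence the identity.\<close>

lemma delta_one: "\<delta> (mat 1) = mat 1"
proof -
  have "\<delta> (mat 1) ** \<delta> (mat 1) = \<delta> (mat 1)"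
    using delta_mult[OF Gam0_one Gam0_one] by simp
  then show ?thesis
    using matrix_inv(1)[OF invertible[OF delta_closed[OF Gam0_one]]]
    by (metis matrix_mul_assoc matrix_mul_rid)
qed

lemma Gam_mult:
  assumes "M \<in> \<Gamma>0" "N \<in> \<Gamma>0"
  shows "gmat \<delta> u v M ** gmat \<delta> u' v' N = gmat \<delta> (u + M *v u') (v + \<delta> M *v v') (M ** N)"
  using assms by (intro gmat_mult delta_mult)

lemma group_Gam: "group (Gam_group \<Gamma>0 \<delta>)"
proof (rule groupI)
  fix g h assume "g \<in> carrier (Gam_group \<Gamma>0 \<delta>)" "h \<in> carrier (Gam_group \<Gamma>0 \<delta>)"
  then show "g \<otimes>\<^bsub>Gam_group \<Gamma>0 \<delta>\<^esub> h \<in> carrier (Gam_group \<Gamma>0 \<delta>)"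
    by (auto simp: Gam_def GL_def Gam_mult) (use Gam0_mult in blast)
next
  show "\<one>\<^bsub>Gam_group \<Gamma>0 \<delta>\<^esub> \<in> carrier (Gam_group \<Gamma>0 \<delta>)"
    using Gam0_one gmat_one[of \<delta>, OF delta_one, symmetric] by (auto simp: Gam_def GL_def)
next
  fix g assume "g \<in> carrier (Gam_group \<Gamma>0 \<delta>)"
  then obtain u v M where M: "M \<in> \<Gamma>0" and g: "g = gmat \<delta> u v M"
    by (auto simp: Gam_def)
  let ?N = "matrix_inv M"
  \<comment> \<open>The translation parts solve \<open>u' + ?N *v u = 0\<close> and
    \<open>v' + \<delta> ?N *v v = 0\<close>.\<close>
  have "gmat \<delta> (- (?N *v u)) (- (\<delta> ?N *v v)) ?N ** g = mat 1"
    using M by (simp add: g Gam_mult Gam0_inv matrix_inv invertible gmat_one delta_one)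
  then show "\<exists>h\<in>carrier (Gam_group \<Gamma>0 \<delta>). h \<otimes>\<^bsub>Gam_group \<Gamma>0 \<delta>\<^esub> g = \<one>\<^bsub>Gam_group \<Gamma>0 \<delta>\<^esub>"
    using Gam0_inv[OF M] by (auto simp: Gam_def GL_def)
qed (auto simp: GL_def matrix_mul_assoc)

text \<open>The factor from \<open>transl \<delta> B\<close> supplies the translation part and the
  factor from \<open>Gam0' \<Gamma>0 \<delta>\<close> the linear part, so \<open>\<Xi>\<close> is
  parametrized by pairs \<open>u\<close>, \<open>M\<close>.\<close>

lemma Xi_eq: "Xi \<Gamma>0 \<delta> B = {gmat \<delta> u (B *v u) M |u M. M \<in> \<Gamma>0}"
proof -
  have mult: "gmat \<delta> u (B *v u) (mat 1) ** gmat \<delta> 0 0 M = gmat \<delta> u (B *v u) M" if "M \<in> \<Gamma>0" for u M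
    by (simp add: Gam_mult that Gam0_one)
  have "Xi \<Gamma>0 \<delta> B = {gmat \<delta> u (B *v u) (mat 1) ** gmat \<delta> 0 0 M |u M. M \<in> \<Gamma>0}"
    unfolding Xi_def set_mult_def transl_def Gam0'_def by (auto simp: GL_def)
  also have "\<dots> = {gmat \<delta> u (B *v u) M |u M. M \<in> \<Gamma>0}"
    by (intro Collect_cong) (metis mult)
  finally show ?thesis .
qed

text \<open>The image of \<open>A\<close> under conjugation by \<open>M\<close> twisted by
  \<open>\<delta>\<close>.\<close>

definition slope :: "'k^'n^'n \<Rightarrow> 'k^'n^'n" where
  "slope M = \<delta> M ** A ** matrix_inv M"

lemma slope_one: "slope (mat 1) = A"
  by (simp add: slope_def delta_one matrix_inv_unique[of "mat 1" "mat 1"])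

text \<open>Twisted conjugation of slopes becomes left multiplication of their parameters.\<close>

lemma slope_mult:
  assumes M: "M \<in> \<Gamma>0" and N: "N \<in> \<Gamma>0"
  shows "\<delta> M ** slope N ** matrix_inv M = slope (M ** N)"
proof -
  have "matrix_inv (M ** N) = matrix_inv N ** matrix_inv M"
    by (rule matrix_inv_unique)
       (metis M N invertible matrix_inv matrix_mul_assoc matrix_mul_rid)+
  then show ?thesis
    by (simp add: slope_def delta_mult M N matrix_mul_assoc)
qed

lemma invertible_slope: "M \<in> \<Gamma>0 \<Longrightarrow> invertible (slope M)"
  using A by (simp add: slope_def GL_def invertible_mult invertible delta_closed Gam0_inv)

lemma act_gmat_graph:
  assumes "M \<in> \<Gamma>0" "N \<in> \<Gamma>0"
  shows "act (gmat \<delta> u v M) (graph (slope N) w)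
    = graph (slope (M ** N)) (v + \<delta> M *v w - slope (M ** N) *v u)"
  using assms act_graph[of M "matrix_inv M" \<delta> u v "slope N" w]
  by (simp add: matrix_inv invertible slope_mult)

lemma act_gmat_Q:
  assumes "M \<in> \<Gamma>0"
  shows "act (gmat \<delta> u v M) (Q A) = graph (slope M) (v - slope M *v u)"
  using act_gmat_graph[OF assms Gam0_one, of u v 0] by (simp add: slope_one Q_eq_graph)

text \<open>Equal slopes make \<open>matrix_inv N ** M\<close> fix \<open>A\<close> under twisted
  conjugation, so the corresponding block matrix stabilizes \<open>Q A\<close>. It therefore lies in
  \<open>transl \<delta> A\<close>, whose elements have linear part the identity.\<close>

lemma slope_inject:
  assumes M: "M \<in> \<Gamma>0" and N: "N \<in> \<Gamma>0" and eq: "slope M = slope N"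
  shows "M = N"
proof -
  let ?K = "matrix_inv N ** M"
  have K: "?K \<in> \<Gamma>0"
    using M N by (simp add: Gam0_mult Gam0_inv)
  have "slope ?K = A"
    using slope_mult[OF Gam0_inv[OF N] M] slope_mult[OF Gam0_inv[OF N] N]
    by (simp add: eq matrix_inv invertible N slope_one)
  then have "gmat \<delta> 0 0 ?K \<in> stabilizer (Gam_group \<Gamma>0 \<delta>) act (Q A)"
    using K act_gmat_Q[OF K, of 0 0] by (auto simp: stabilizer_def Gam_def Q_eq_graph)
  then have "?K = mat 1"
    unfolding stabilizer[symmetric] by (auto simp: transl_def dest: gmat_inject)
  then show ?thesis
    by (metis N invertible matrix_inv(1) matrix_mul_assoc matrix_mul_lid matrix_mul_rid)
qed

text \<open>If \<open>slope M *v x = B *v x\<close>, then \<open>matrix_inv M *v x\<close> is fixed by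
  \<open>matrix_inv M ** matrix_inv B ** \<delta> M ** A\<close>.\<close>

lemma slope_eq_B:
  assumes M: "M \<in> \<Gamma>0" and eq: "slope M *v x = B *v x"
  shows "x = 0"
proof (rule ccontr)
  assume "x \<noteq> 0"
  let ?y = "matrix_inv M *v x"
  have My: "M *v ?y = x"
    using M by (simp add: matrix_vector_mul_assoc matrix_inv invertible)
  have "invertible B"
    using B by (simp add: GL_def)
  have "(matrix_inv M ** matrix_inv B ** \<delta> M ** A) *v ?y = matrix_inv M *v (matrix_inv B *v (slope M *v x))"
    by (simp add: slope_def matrix_vector_mul_assoc matrix_mul_assoc)
  also have "\<dots> = ?y"
    using \<open>invertible B\<close> by (simp add: eq matrix_vector_mul_assoc[of "matrix_inv B" B] matrix_inv)
  finally have "(matrix_inv M ** matrix_inv B ** \<delta> M ** A) *v ?y = 1 *s ?y"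
    by simp
  moreover have "?y \<noteq> 0"
    using My \<open>x \<noteq> 0\<close> by auto
  ultimately show False
    using no_eigenvalue M unfolding eigenvalue_def by blast
qed

text \<open>\<open>B - slope M\<close> has trivial kernel by \<open>slope_eq_B\<close>, and a square
  matrix over a field with trivial kernel is invertible.\<close>

lemma ex1_B_minus_slope:
  assumes M: "M \<in> \<Gamma>0"
  shows "\<exists>!u. B *v u - slope M *v u = z"
proof -
  let ?D = "B - slope M"
  have D: "?D *v x = B *v x - slope M *v x" for x
    by (rule matrix_vector_mult_diff_rdistrib)
  have "x = 0" if "?D *v x = 0" for x
    using that slope_eq_B[OF M, of x] by (simp add: D)
  then have "invertible ?D"
    unfolding invertible_left_inverse matrix_left_invertible_ker by blast
  then have "?D *v (matrix_inv ?D *v x) = x" "matrix_inv ?D *v (?D *v x) = x" for x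
    by (simp_all add: matrix_vector_mul_assoc matrix_inv)
  then show ?thesis
    unfolding D[symmetric] by metis
qed

section \<open>The orbit of \<open>Q A\<close> and the sharp transitivity of
  \<open>\<Xi>\<close>\<close>

lemma quotient: "N \<in> \<Gamma>0 \<Longrightarrow> M ** N = P \<longleftrightarrow> M = P ** matrix_inv N"
  by (auto simp: matrix_inv invertible simp flip: matrix_mul_assoc)

lemma orbit_eq: "orbit (Gam_group \<Gamma>0 \<delta>) act (Q A) = {graph (slope M) w |M w. M \<in> \<Gamma>0}"
proof (intro equalityI subsetI)
  fix X assume "X \<in> orbit (Gam_group \<Gamma>0 \<delta>) act (Q A)"
  then obtain u v M where "M \<in> \<Gamma>0" "X = act (gmat \<delta> u v M) (Q A)"
    by (auto simp: orbit_def Gam_def)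
  then show "X \<in> {graph (slope M) w |M w. M \<in> \<Gamma>0}"
    using act_gmat_Q by blast
next
  fix X assume "X \<in> {graph (slope M) w |M w. M \<in> \<Gamma>0}"
  then obtain M w where M: "M \<in> \<Gamma>0" and X: "X = graph (slope M) w"
    by blast
  \<comment> \<open>With \<open>u = 0\<close> the slope contributes nothing to the offset, which is
    then \<open>w\<close> itself.\<close>
  have "X = act (gmat \<delta> 0 w M) (Q A)"
    by (simp add: X act_gmat_Q M)
  moreover have "gmat \<delta> 0 w M \<in> carrier (Gam_group \<Gamma>0 \<delta>)"
    using M by (auto simp: Gam_def)
  ultimately show "X \<in> orbit (Gam_group \<Gamma>0 \<delta>) act (Q A)"
    unfolding orbit_def by blast
qed

text \<open>The two parameters separate: comparing slopes determines \<open>M\<close>, and comparing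
  offsets then leaves a uniquely solvable linear equation for \<open>u\<close>.\<close>

lemma sharply_transitive_Xi:
  "sharply_transitive (Xi \<Gamma>0 \<delta> B) (orbit (Gam_group \<Gamma>0 \<delta>) act (Q A)) act"
  unfolding sharply_transitive_def
proof (intro conjI ballI)
  fix s X assume "s \<in> Xi \<Gamma>0 \<delta> B" "X \<in> orbit (Gam_group \<Gamma>0 \<delta>) act (Q A)"
  then show "act s X \<in> orbit (Gam_group \<Gamma>0 \<delta>) act (Q A)"
    unfolding Xi_eq orbit_eq by (auto simp: act_gmat_graph) (metis Gam0_mult)
next
  fix X Y
  assume "X \<in> orbit (Gam_group \<Gamma>0 \<delta>) act (Q A)" "Y \<in> orbit (Gam_group \<Gamma>0 \<delta>) act (Q A)"
  then obtain N w P z where N: "N \<in> \<Gamma>0" and X: "X = graph (slope N) w"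
    and P: "P \<in> \<Gamma>0" and Y: "Y = graph (slope P) z"
    unfolding orbit_eq by blast
  \<comment> \<open>By \<open>slope_inject\<close>, equality of slopes forces
    \<open>M ** N = P\<close>.\<close>
  define M where "M = P ** matrix_inv N"
  have M: "M \<in> \<Gamma>0" "M ** N = P"
    using N P by (simp_all add: M_def Gam0_mult Gam0_inv matrix_inv invertible flip: matrix_mul_assoc)
  have M_unique: "M' = M" if "M' ** N = P" for M'
    using that N by (auto simp: M_def matrix_inv invertible simp flip: matrix_mul_assoc)
  \<comment> \<open>The image of \<open>X\<close> has offset
    \<open>B *v u + \<delta> M *v w - slope P *v u\<close>, which has to equal
    \<open>z\<close>.\<close>
  obtain u where u: "B *v u - slope P *v u = z - \<delta> M *v w"
    and u_unique: "\<And>u'. B *v u' - slope P *v u' = z - \<delta> M *v w \<Longrightarrow> u' = u"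
    using ex1_B_minus_slope[OF P] by metis
  show "\<exists>!s. s \<in> Xi \<Gamma>0 \<delta> B \<and> act s X = Y"
  proof (rule ex1I[of _ "gmat \<delta> u (B *v u) M"])
    show "gmat \<delta> u (B *v u) M \<in> Xi \<Gamma>0 \<delta> B \<and> act (gmat \<delta> u (B *v u) M) X = Y"
      using M N u by (auto simp: Xi_eq X Y act_gmat_graph algebra_simps)
  next
    fix s assume s: "s \<in> Xi \<Gamma>0 \<delta> B \<and> act s X = Y"
    then obtain u' M' where M': "M' \<in> \<Gamma>0" and s_eq: "s = gmat \<delta> u' (B *v u') M'"
      by (auto simp: Xi_eq)
    have eq: "slope (M' ** N) = slope P"
      "B *v u' + \<delta> M' *v w - slope (M' ** N) *v u' = z"
      using s M' N by (auto simp: s_eq X Y act_gmat_graph)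
    have "M' = M"
      by (rule M_unique, rule slope_inject) (use eq M' N P Gam0_mult in auto)
    moreover from this have "u' = u"
      using eq(2)[unfolded eq(1)] by (intro u_unique) (simp add: algebra_simps)
    ultimately show "s = gmat \<delta> u (B *v u) M"
      by (simp add: s_eq)
  qed
qed

text \<open>Makes the abstract loops available for \<open>\<Gamma>\<close> with base point
  \<open>Q A\<close>; the identity lies in \<open>\<Xi>\<close> as the element with
  \<open>u = 0\<close> and \<open>M = mat 1\<close>.\<close>

sublocale sharp_transversal "Gam_group \<Gamma>0 \<delta>" UNIV act "Q A" "Xi \<Gamma>0 \<delta> B"
proof -
  interpret group_action "Gam_group \<Gamma>0 \<delta>" UNIV act
    by (rule group_action_act[OF group_Gam])
  show "sharp_transversal (Gam_group \<Gamma>0 \<delta>) UNIV act (Q A) (Xi \<Gamma>0 \<delta> B)"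
  proof
    have "gmat \<delta> 0 (B *v 0) (mat 1) = mat 1"
      by (simp add: gmat_one delta_one)
    then show "\<one>\<^bsub>Gam_group \<Gamma>0 \<delta>\<^esub> \<in> Xi \<Gamma>0 \<delta> B"
      unfolding Xi_eq using Gam0_one by (intro CollectI exI[of _ 0] exI[of _ "mat 1"]) (simp add: GL_def)
    show "Xi \<Gamma>0 \<delta> B \<subseteq> carrier (Gam_group \<Gamma>0 \<delta>)"
      by (auto simp: Xi_eq Gam_def)
  qed (simp_all add: sharply_transitive_Xi)
qed

text \<open>\<open>\<Xi>\<close> alone already reaches every point of the orbit of
  \<open>\<Gamma>\<close>.\<close>

lemma Ohat_eq: "Ohat \<Gamma>0 \<delta> A B = orbit (Gam_group \<Gamma>0 \<delta>) act (Q A)"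
  by (simp add: Ohat_def orbit_eq_S)

text \<open>The stabilizer hypothesis turns cosets of \<open>transl \<delta> A\<close> into cosets
  of the stabilizer, and \<open>sigma\<close> is then \<open>representative\<close>.\<close>

lemma L_Xi_eq: "L_Xi \<Gamma>0 \<delta> A B = coset_loop"
  by (simp add: L_Xi_def coset_loop_def representative_def sigma_def stabilizer)

lemma L_Xi'_eq: "L_Xi' \<Gamma>0 \<delta> A B = orbit_loop"
  by (simp add: L_Xi'_def orbit_loop_def transporter_def tau_def Ohat_eq)

section \<open>Traces at infinity and intersections with \<open>Q B\<close>\<close>

lemma Orb0_eq: "Orb0 \<Gamma>0 \<delta> A = {Q (slope M) |M. M \<in> \<Gamma>0}"
proof -
  have act: "act (gmat \<delta> 0 0 M) (Q A) = Q (slope M)" if "M \<in> \<Gamma>0" for M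
    using act_gmat_Q[OF that, of 0 0] by (simp add: Q_eq_graph)
  have "Orb0 \<Gamma>0 \<delta> A = {act (gmat \<delta> 0 0 M) (Q A) |M. M \<in> \<Gamma>0}"
    by (auto simp: Orb0_def Gam0'_def)
  also have "\<dots> = {Q (slope M) |M. M \<in> \<Gamma>0}"
    unfolding setcompr_eq_image by (rule image_cong) (simp_all add: act)
  finally show ?thesis .
qed

lemma traces_eq: "traces (Orb0 \<Gamma>0 \<delta> A) = {trace_Q (slope M) |M. M \<in> \<Gamma>0}"
proof -
  have "invertible C \<and> Q C \<in> Orb0 \<Gamma>0 \<delta> A \<longleftrightarrow> C \<in> slope ` \<Gamma>0" for C
    using invertible_slope by (auto simp: Orb0_eq Q_eq_graph)
  then show ?thesis
    unfolding traces_def by (simp add: setcompr_eq_image image_image)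
qed

text \<open>\<open>trace_Q_inject\<close> and \<open>slope_inject\<close> label the traces
  bijectively by \<open>\<Gamma>0\<close>, with the action becoming left multiplication; the regular
  action of a group is sharply transitive.\<close>

lemma sharply_transitive_traces:
  "sharply_transitive (Gam0' \<Gamma>0 \<delta>) (traces (Orb0 \<Gamma>0 \<delta> A)) act_trace"
proof -
  have act: "act_trace (gmat \<delta> 0 0 M) (trace_Q (slope N)) = trace_Q (slope (M ** N))"
    if "M \<in> \<Gamma>0" "N \<in> \<Gamma>0" for M N
    using that act_trace_Q[of M "matrix_inv M" \<delta> "slope N"]
    by (simp add: matrix_inv invertible slope_mult)
  have closed: "act_trace s T \<in> traces (Orb0 \<Gamma>0 \<delta> A)"
    if s: "s \<in> Gam0' \<Gamma>0 \<delta>" and T: "T \<in> traces (Orb0 \<Gamma>0 \<delta> A)" for s T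
  proof -
    obtain M where "M \<in> \<Gamma>0" "s = gmat \<delta> 0 0 M"
      using s by (auto simp: Gam0'_def)
    moreover obtain N where "N \<in> \<Gamma>0" "T = trace_Q (slope N)"
      using T by (auto simp: traces_eq)
    ultimately show ?thesis
      unfolding traces_eq using act Gam0_mult by blast
  qed
  have ex1: "\<exists>!s. s \<in> Gam0' \<Gamma>0 \<delta> \<and> act_trace s T = U"
    if T: "T \<in> traces (Orb0 \<Gamma>0 \<delta> A)" and U: "U \<in> traces (Orb0 \<Gamma>0 \<delta> A)" for T U
  proof -
    obtain N where N: "N \<in> \<Gamma>0" and T_eq: "T = trace_Q (slope N)"
      using T by (auto simp: traces_eq)
    obtain P where P: "P \<in> \<Gamma>0" and U_eq: "U = trace_Q (slope P)"
      using U by (auto simp: traces_eq)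
    let ?M = "P ** matrix_inv N"
    have M: "?M \<in> \<Gamma>0" "?M ** N = P"
      using quotient[OF N] N P by (auto intro: Gam0_mult Gam0_inv)
    show ?thesis
    proof (rule ex1I)
      have "gmat \<delta> 0 0 ?M \<in> Gam0' \<Gamma>0 \<delta>"
        using M(1) unfolding Gam0'_def by blast
      then show "gmat \<delta> 0 0 ?M \<in> Gam0' \<Gamma>0 \<delta> \<and> act_trace (gmat \<delta> 0 0 ?M) T = U"
        by (simp only: T_eq U_eq act M N simp_thms)
    next
      fix s assume s: "s \<in> Gam0' \<Gamma>0 \<delta> \<and> act_trace s T = U"
      then obtain M' where M': "M' \<in> \<Gamma>0" and s_eq: "s = gmat \<delta> 0 0 M'"
        by (auto simp: Gam0'_def)
      have "trace_Q (slope (M' ** N)) = trace_Q (slope P)"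
        using conjunct2[OF s] unfolding s_eq T_eq U_eq by (simp only: act M' N)
      then have "M' ** N = P"
        by (rule slope_inject[OF Gam0_mult[OF M' N] P trace_Q_inject])
      then show "s = gmat \<delta> 0 0 ?M"
        by (simp only: quotient[OF N] s_eq)
    qed
  qed
  show ?thesis
    unfolding sharply_transitive_def using closed ex1 by blast
qed

text \<open>A common point has \<open>B *v x = slope M *v x\<close>, so \<open>x = 0\<close> by
  \<open>slope_eq_B\<close>; the only common point is (1,0,0).\<close>

lemma ex1_Q_B_inter:
  assumes "X \<in> Orb0 \<Gamma>0 \<delta> A"
  shows "\<exists>!p. p \<in> Q B \<inter> X"
proof -
  obtain M where M: "M \<in> \<Gamma>0" "X = Q (slope M)"
    using assms by (auto simp: Orb0_eq)
  have "p \<in> Q B \<inter> X \<longleftrightarrow> p = vec3 1 0 0" for p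
    using slope_eq_B[OF M(1)] by (force simp: M(2) Q_def)
  then show ?thesis
    by simp
qed

end

theorem theorem3:
  fixes \<Gamma>0 :: "('k::field^'n^'n) set"
    and \<delta> :: "'k^'n^'n \<Rightarrow> 'k^'n^'n"
    and A B :: "'k^'n^'n"
  assumes "subgroup \<Gamma>0 GL"
    and "\<Gamma>0 \<noteq> {mat 1}"
    and "\<delta> \<in> hom (GL\<lparr>carrier := \<Gamma>0\<rparr>) (GL\<lparr>carrier := \<Gamma>0\<rparr>)"
    and "A \<in> carrier GL"
    and "B \<in> carrier GL"
    and "\<forall>M\<in>\<Gamma>0. \<not> eigenvalue (matrix_inv M ** matrix_inv B ** \<delta> M ** A) 1"
    and "transl \<delta> A = stabilizer (Gam_group \<Gamma>0 \<delta>) act (Q A)"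
  shows "loop (L_Xi \<Gamma>0 \<delta> A B)
    \<and> Ohat \<Gamma>0 \<delta> A B = orbit (Gam_group \<Gamma>0 \<delta>) act (Q A)
    \<and> (\<forall>X\<in>Ohat \<Gamma>0 \<delta> A B. \<exists>!\<psi>. \<psi> \<in> Xi \<Gamma>0 \<delta> B \<and> act \<psi> (Q A) = X)
    \<and> loop (L_Xi' \<Gamma>0 \<delta> A B)
    \<and> L_Xi \<Gamma>0 \<delta> A B \<cong> L_Xi' \<Gamma>0 \<delta> A B
    \<and> sharply_transitive (Gam0' \<Gamma>0 \<delta>) (traces (Orb0 \<Gamma>0 \<delta> A)) act_trace
    \<and> (\<forall>X\<in>Orb0 \<Gamma>0 \<delta> A. \<exists>!p. p \<in> Q B \<inter> X)"
proof -
  interpret twisted_action \<Gamma>0 \<delta> A B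
    by (rule twisted_action.intro) (rule assms)+
  show ?thesis
    unfolding L_Xi_eq L_Xi'_eq Ohat_eq
    using loop_coset_loop loop_orbit_loop coset_point_iso ex1_transporter
      sharply_transitive_traces ex1_Q_B_inter
    by (auto intro: is_isoI)
qed

end
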